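(* Let $L>0$, let $(\eta_t)_{t=0}^{\infty}$ be a sequence of nonnegative stepsizes, and let $T\in\mathbb{N}$ satisfy $$\min\left\{\frac{\eta_T}{2},\ \sum_{t=0}^{T-1}\eta_t\right\}\ge\frac{1}{L}.$$ Then there exist an $L$-smooth convex function $f:\mathbb{R}\to\mathbb{R}$ that attains its infimum $f^*$, and an initial point $x_0\in\mathbb{R}$ that is not a minimizer of $f$, such that for every minimizer $x^*$ of $f$ the gradient descent iterates $x_{t+1}=x_t-\eta_t f'(x_t)$ started at $x_0$ satisfy $$f(x_{T+1})-f^*\ \ge\ \frac{1}{32}\,L\,|x_0-x^*|^2\left(\frac{\eta_T}{\sum_{t=0}^{T-1}\eta_t}\right)^2.$$
   Context: $\mathbb{N}=\{1,2,3,\dots\}$. A function $f:\mathbb{R}\to\mathbb{R}$ is $L$-smooth if it is differentiable and $f'$ is $L$-Lipschitz. *)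

theory Defs
  imports "HOL-Analysis.Analysis"
begin

definition smooth_fun :: "real \<Rightarrow> (real \<Rightarrow> real) \<Rightarrow> bool" where
  "smooth_fun L f \<longleftrightarrow> (\<forall>x. f differentiable (at x)) \<and> L-lipschitz_on UNIV (deriv f)"

abbreviation is_minimizer :: "(real \<Rightarrow> real) \<Rightarrow> real \<Rightarrow> bool" where
  "is_minimizer f x \<equiv> is_arg_min f (\<lambda>_. True) x"

primrec gd_iter :: "(real \<Rightarrow> real) \<Rightarrow> (nat \<Rightarrow> real) \<Rightarrow> real \<Rightarrow> nat \<Rightarrow> real" where
  "gd_iter f \<eta> x0 0 = x0"
| "gd_iter f \<eta> x0 (Suc t) = gd_iter f \<eta> x0 t - \<eta> t * deriv f (gd_iter f \<eta> x0 t)"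

end

theory Submission
  imports Defs
begin

text \<open>
  The witness is a one-sided Huber function \<open>f\<close>: the parabola \<open>L x\<^sup>2 / 2\<close> continued to the right of
  \<open>1 / L\<close> by its tangent, so that \<open>f' x = min (L x) 1\<close> and \<open>0\<close> is the only minimizer. Write
  \<open>S = \<eta>\<^sub>0 + \<dots> + \<eta>\<^sub>T\<^sub>-\<^sub>1\<close>. On the linear part gradient descent sees slope \<open>1\<close> and merely subtracts
  its stepsizes; the starting point \<open>x\<^sub>0 = 1 / L + S\<close> is chosen so that the first \<open>T\<close> steps end
  exactly at the kink \<open>1 / L\<close>, where the slope is still \<open>1\<close>. The long step \<open>\<eta>\<^sub>T\<close> then overshoots
  the minimizer and lands on the parabola at \<open>1 / L - \<eta>\<^sub>T\<close>, with value \<open>L (\<eta>\<^sub>T - 1 / L)\<^sup>2 / 2\<close>.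

  Both halves of the hypothesis enter as comparisons with \<open>1 / L\<close>: from \<open>\<eta>\<^sub>T \<ge> 2 / L\<close> the value is
  at least \<open>L \<eta>\<^sub>T\<^sup>2 / 8\<close>, and from \<open>S \<ge> 1 / L\<close> the initial distance to the minimizer is at most
  \<open>2 S\<close>. The product of \<open>1/8\<close> and \<open>1/4\<close> is the constant \<open>1/32\<close>.
\<close>

definition half_huber :: "real \<Rightarrow> real \<Rightarrow> real" where
  "half_huber L x = (if x \<le> 1 / L then L * x\<^sup>2 / 2 else x - 1 / (2 * L))"

lemma has_real_derivative_half_huber:
  assumes "L > 0"
  shows "(half_huber L has_real_derivative min (L * x) 1) (at x)"
proof -
  have closures: "closure {..1 / L} \<inter> closure {1 / L<..} = {1 / L}"
    by auto
  have "((\<lambda>x. if x \<in> {..1 / L} then L * x\<^sup>2 / 2 else x - 1 / (2 * L)) has_vector_derivative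
      (if x \<in> {..1 / L} then L * x else 1)) (at x within UNIV)"
  proof (rule has_vector_derivative_If_within_closures[where T = "{1 / L<..}"])
    show "((\<lambda>x. L * x\<^sup>2 / 2) has_vector_derivative L * x)
        (at x within {..1 / L} \<union> closure {..1 / L} \<inter> closure {1 / L<..})"
      unfolding has_real_derivative_iff_has_vector_derivative[symmetric]
      by (auto intro!: derivative_eq_intros)
    show "((\<lambda>x. x - 1 / (2 * L)) has_vector_derivative 1)
        (at x within {1 / L<..} \<union> closure {..1 / L} \<inter> closure {1 / L<..})"
      unfolding has_real_derivative_iff_has_vector_derivative[symmetric]
      by (auto intro!: derivative_eq_intros)
  qed (use assms in \<open>auto simp: closures, auto simp: power2_eq_square field_simps\<close>)
  moreover have "(if x \<in> {..1 / L} then L * x else 1) = min (L * x) 1"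
    using assms by (auto simp: min_def field_simps)
  ultimately show ?thesis
    by (simp add: has_real_derivative_iff_has_vector_derivative half_huber_def[abs_def])
qed

lemma deriv_half_huber: "L > 0 \<Longrightarrow> deriv (half_huber L) x = min (L * x) 1"
  by (rule DERIV_imp_deriv[OF has_real_derivative_half_huber])

lemma smooth_half_huber:
  assumes "L > 0"
  shows "smooth_fun L (half_huber L)"
  unfolding smooth_fun_def
proof (intro conjI allI lipschitz_onI)
  show "half_huber L differentiable (at x)" for x
    using has_real_derivative_half_huber[OF assms] real_differentiable_def by blast
  show "dist (deriv (half_huber L) x) (deriv (half_huber L) y) \<le> L * dist x y" for x y
  proof -
    \<comment> \<open>Truncation from above does not increase distances.\<close>
    have "\<bar>min (L * x) 1 - min (L * y) 1\<bar> \<le> \<bar>L * x - L * y\<bar>"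
      by linarith
    also have "\<dots> = L * \<bar>x - y\<bar>"
      using assms by (simp add: abs_mult flip: right_diff_distrib)
    finally show ?thesis
      using assms by (simp add: deriv_half_huber dist_real_def)
  qed
qed (use assms in simp)

lemma convex_half_huber:
  assumes "L > 0"
  shows "convex_on UNIV (half_huber L)"
proof (rule convex_on_realI)
  show "(half_huber L has_real_derivative min (L * x) 1) (at x)" for x
    by (rule has_real_derivative_half_huber[OF assms])
  show "min (L * x) 1 \<le> min (L * y) 1" if "x \<le> y" for x y
    using assms that by (intro min.mono mult_left_mono) auto
qed simp

lemma half_huber_zero: "L > 0 \<Longrightarrow> half_huber L 0 = 0"
  by (simp add: half_huber_def)

lemma half_huber_pos:
  assumes "L > 0" "x \<noteq> 0"
  shows "half_huber L x > 0"
proof (cases "x \<le> 1 / L")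
  case True
  then show ?thesis using assms by (simp add: half_huber_def)
next
  case False
  moreover have "1 / (2 * L) < 1 / L"
    using assms by (simp add: field_simps)
  ultimately show ?thesis by (simp add: half_huber_def)
qed

lemma half_huber_nonneg: "L > 0 \<Longrightarrow> half_huber L x \<ge> 0"
  by (metis half_huber_pos half_huber_zero less_eq_real_def)

lemma is_minimizer_half_huber_iff:
  assumes "L > 0"
  shows "is_minimizer (half_huber L) x \<longleftrightarrow> x = 0"
proof
  assume "is_minimizer (half_huber L) x"
  then have "\<not> half_huber L 0 < half_huber L x"
    by (simp add: is_arg_min_def)
  then show "x = 0"
    using half_huber_pos[OF assms] half_huber_zero[OF assms] by auto
next
  assume "x = 0"
  then show "is_minimizer (half_huber L) x"
    using half_huber_nonneg[OF assms] by (simp add: is_arg_min_def half_huber_zero[OF assms] not_less)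
qed

lemma Inf_half_huber:
  assumes "L > 0"
  shows "(INF x. half_huber L x) = 0"
proof (rule cInf_eq_minimum)
  show "0 \<in> range (half_huber L)"
    using half_huber_zero[OF assms] by (metis rangeI)
qed (use half_huber_nonneg[OF assms] in auto)

text \<open>
  All stepsizes up to time \<open>T\<close> are nonnegative, so a run that would end at the kink \<open>1 / L\<close> if the
  slope were constantly \<open>1\<close> never leaves the linear part, and the slope is in fact constantly \<open>1\<close>.
\<close>

lemma gd_iter_half_huber:
  assumes "L > 0" and nonneg: "\<And>t. \<eta> t \<ge> 0" and "t \<le> T"
  shows "gd_iter (half_huber L) \<eta> (1 / L + (\<Sum>i<T. \<eta> i)) t = 1 / L + (\<Sum>i\<in>{t..<T}. \<eta> i)"
  using \<open>t \<le> T\<close>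
proof (induction t)
  case 0
  then show ?case by (simp add: atLeast0LessThan)
next
  case (Suc t)
  define r where "r = (\<Sum>i\<in>{t..<T}. \<eta> i)"
  have "r \<ge> 0"
    unfolding r_def by (intro sum_nonneg nonneg)
  then have "deriv (half_huber L) (1 / L + r) = 1"
    using \<open>L > 0\<close> by (simp add: deriv_half_huber distrib_left)
  moreover have "r = \<eta> t + (\<Sum>i\<in>{Suc t..<T}. \<eta> i)"
    unfolding r_def using Suc.prems by (simp add: sum.atLeast_Suc_lessThan)
  ultimately show ?case
    using Suc by (simp add: r_def)
qed

theorem theorem2:
  fixes L :: real and \<eta> :: "nat \<Rightarrow> real" and T :: nat
  assumes "L > 0"
    and "\<And>t. \<eta> t \<ge> 0"
    and "T \<ge> 1"
    and "min (\<eta> T / 2) (\<Sum>t<T. \<eta> t) \<ge> 1 / L"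
  shows "\<exists>(f :: real \<Rightarrow> real) (x0 :: real).
    smooth_fun L f \<and> convex_on UNIV f \<and> (\<exists>x. is_minimizer f x) \<and> \<not> is_minimizer f x0 \<and>
    (\<forall>xs. is_minimizer f xs \<longrightarrow>
      f (gd_iter f \<eta> x0 (T + 1)) - (INF x. f x)
        \<ge> 1 / 32 * L * \<bar>x0 - xs\<bar>\<^sup>2 * (\<eta> T / (\<Sum>t<T. \<eta> t))\<^sup>2)"
proof -
  define S where "S = (\<Sum>t<T. \<eta> t)"
  define x0 where "x0 = 1 / L + S"
  have L: "1 / L > 0" and S: "1 / L \<le> S" and \<eta>T: "2 * (1 / L) \<le> \<eta> T"
    using assms by (auto simp: S_def)
  have x0: "0 < x0" "x0 \<le> 2 * S"
    unfolding x0_def using L S by linarith+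
  have "gd_iter (half_huber L) \<eta> x0 T = 1 / L"
    using gd_iter_half_huber[of L \<eta> T T] assms(1,2) by (simp add: x0_def S_def)
  then have "gd_iter (half_huber L) \<eta> x0 (T + 1) = 1 / L - \<eta> T"
    using assms(1) by (simp add: deriv_half_huber)
  then have overshoot:
    "half_huber L (gd_iter (half_huber L) \<eta> x0 (T + 1)) = L * (\<eta> T - 1 / L)\<^sup>2 / 2"
    using assms(2)[of T] by (simp add: half_huber_def power2_commute)
  have "(x0 / S)\<^sup>2 \<le> 2\<^sup>2"
    using x0 L S by (intro power_mono) (auto simp: divide_le_eq)
  then have "L * (\<eta> T)\<^sup>2 / 32 * (x0 / S)\<^sup>2 \<le> L * (\<eta> T)\<^sup>2 / 32 * 2\<^sup>2"
    using assms(1) by (intro mult_left_mono) auto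
  also have "\<dots> = L * (\<eta> T / 2)\<^sup>2 / 2"
    by (simp add: power_divide)
  also have "\<dots> \<le> L * (\<eta> T - 1 / L)\<^sup>2 / 2"
    using assms(1) \<eta>T assms(2)[of T]
    by (intro divide_right_mono mult_left_mono power_mono) auto
  finally have "1 / 32 * L * \<bar>x0 - 0\<bar>\<^sup>2 * (\<eta> T / S)\<^sup>2
      \<le> half_huber L (gd_iter (half_huber L) \<eta> x0 (T + 1)) - (INF x. half_huber L x)"
    unfolding overshoot Inf_half_huber[OF assms(1)] by (simp add: power_divide mult_ac)
  moreover have "\<not> is_minimizer (half_huber L) x0"
    using x0 is_minimizer_half_huber_iff[OF assms(1)] by simp
  ultimately show ?thesis
    unfolding S_def
    by (intro exI[of _ "half_huber L"] exI[of _ x0])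
      (simp add: smooth_half_huber convex_half_huber is_minimizer_half_huber_iff assms(1))
qed

end
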